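(* Let $\rho\in\mathbb{N}$, and let $\alpha,\beta,\delta_1,\dots,\delta_\rho\in(-1,+\infty)$ and $\kappa_1,\dots,\kappa_\rho\in\mathbb{N}$ be arbitrary parameters. Then the following hold for all $n\in\mathbb{Z}_+$. If $\rho\geq2$, then for all $z\in\mathbb{C}$ with $|z|<1$, $$\mathcal{P}_n(z;\alpha,\beta,\delta_1,\dots,\delta_\rho,\kappa_1,\dots,\kappa_\rho)=\frac{\Gamma(\kappa_\rho+\delta_\rho+1)}{\Gamma(\delta_\rho+1)\Gamma(\kappa_\rho)}\int_0^1t^{\delta_\rho}(1-t)^{\kappa_\rho-1}\mathcal{P}_n(zt;\alpha,\beta,\delta_1,\dots,\delta_{\rho-1},\kappa_1,\dots,\kappa_{\rho-1})\,dt.$$ If $\rho=1$, then for all $z\in\mathbb{C}$ with $|z|<1$, $$\mathcal{P}_n(z;\alpha,\beta,\delta_1,\kappa_1)=\frac{\Gamma(\kappa_1+\delta_1+1)}{\Gamma(\delta_1+1)\Gamma(\kappa_1)}\int_0^1t^{\delta_1}(1-t)^{\kappa_1-1}J_n(zt;\alpha,\beta)\,dt.$$ If $\rho\geq2$, then for all $z\in\mathbb{C}$, $$\mathcal{L}_n(z;\alpha,\delta_1,\dots,\delta_\rho,\kappa_1,\dots,\kappa_\rho)=\frac{\Gamma(\kappa_\rho+\delta_\rho+1)}{\Gamma(\delta_\rho+1)\Gamma(\kappa_\rho)}\int_0^1t^{\delta_\rho}(1-t)^{\kappa_\rho-1}\mathcal{L}_n(zt;\alpha,\delta_1,\dots,\delta_{\rho-1},\kappa_1,\dots,\kappa_{\rho-1})\,dt.$$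 If $\rho=1$, then for all $z\in\mathbb{C}$, $$\mathcal{L}_n(z;\alpha,\delta_1,\kappa_1)=\frac{\Gamma(\kappa_1+\delta_1+1)}{\Gamma(\delta_1+1)\Gamma(\kappa_1)}\int_0^1t^{\delta_1}(1-t)^{\kappa_1-1}L_n(zt;\alpha)\,dt.$$
   Context: $\mathbb{N}$ is the set of positive integers, $\mathbb{Z}_+$ the set of non-negative integers, $\Gamma$ the gamma function. The Pochhammer symbol is $(c)_0=1$, $(c)_k=c(c+1)\cdots(c+k-1)$ for $k\ge1$. The generalized hypergeometric function is $${}_mF_n(a_1,\dots,a_m;b_1,\dots,b_n;x)=\sum_{k=0}^\infty\frac{(a_1)_k\cdots(a_m)_k}{(b_1)_k\cdots(b_n)_k}\frac{x^k}{k!};$$ when an upper parameter is $-n$ with $n\in\mathbb{Z}_+$ it is a polynomial in $x$ (sum over $0\le k\le n$). For any $\rho\in\mathbb{N}$, $\alpha,\beta,\delta_j>-1$, $\kappa_j\in\mathbb{Z}_+$, define $$\mathcal{P}_n(x;\alpha,\beta,\delta_1,\dots,\delta_\rho,\kappa_1,\dots,\kappa_\rho)={}_{\rho+2}F_{\rho+1}(-n,n+\alpha+\beta+1,\delta_1+1,\dots,\delta_\rho+1;\alpha+1,\kappa_1+\delta_1+1,\dots,\kappa_\rho+\delta_\rho+1;x),$$ $$\mathcal{L}_n(x;\alpha,\delta_1,\dots,\delta_\rho,\kappa_1,\dots,\kappa_\rho)={}_{\rho+1}F_{\rho+1}(-n,\delta_1+1,\dots,\delta_\rho+1;\alpha+1,\kappa_1+\delta_1+1,\dots,\kappa_\rho+\delta_\rho+1;x).$$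 Also, $J_n(x;\alpha,\beta)={}_2F_1(-n,n+\alpha+\beta+1;\alpha+1;x)$ and $L_n(x;\alpha)={}_1F_1(-n;\alpha+1;x)$ are the (normalized) Jacobi and Laguerre polynomials. *)

theory Defs
  imports "HOL-Analysis.Analysis"
begin

text \<open>
  The generalized hypergeometric series with upper parameters \<open>as\<close> and lower parameters \<open>bs\<close>.
  It only has its intended meaning where the series converges and no lower parameter is a
  non-positive integer.
\<close>

definition hypergeom :: "complex list \<Rightarrow> complex list \<Rightarrow> complex \<Rightarrow> complex" where
  "hypergeom as bs x =
     (\<Sum>k. (\<Prod>a\<leftarrow>as. pochhammer a k) / (\<Prod>b\<leftarrow>bs. pochhammer b k) * (x ^ k / fact k))"

text \<open>Agreement with the formal hypergeometric series of the library.\<close>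

lemma hypergeom_eq_eval_fps: "hypergeom as bs x = eval_fps (fps_hypergeo as bs 1) x"
proof -
  have "foldl (\<lambda>r a. r * pochhammer a k) c xs = c * (\<Prod>a\<leftarrow>xs. pochhammer a k)"
    for k and c :: complex and xs
    by (induction xs arbitrary: c) (simp_all add: mult.assoc)
  then show ?thesis
    by (simp add: hypergeom_def eval_fps_def)
qed

text \<open>An upper parameter \<open>- n\<close> turns the series into a polynomial of degree at most \<open>n\<close>.\<close>

lemma hypergeom_terminating:
  assumes "- of_nat n \<in> set as"
  shows "hypergeom as bs x =
    (\<Sum>k\<le>n. (\<Prod>a\<leftarrow>as. pochhammer a k) / (\<Prod>b\<leftarrow>bs. pochhammer b k) * (x ^ k / fact k))"
proof -
  have "(\<Prod>a\<leftarrow>as. pochhammer a k) = 0" if "k \<notin> {..n}" for k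
    using assms that by (force simp: prod_list_zero_iff pochhammer_of_nat_eq_0_iff)
  then show ?thesis
    unfolding hypergeom_def by (intro suminf_finite) auto
qed

text \<open>
  The parameters \<open>\<delta> 1, \<dots>, \<delta> \<rho>\<close> and \<open>\<kappa> 1, \<dots>, \<kappa> \<rho>\<close> are given by functions on the natural numbers,
  of which only the values at \<open>1, \<dots>, \<rho>\<close> are used.
\<close>

definition calP ::
  "nat \<Rightarrow> nat \<Rightarrow> real \<Rightarrow> real \<Rightarrow> (nat \<Rightarrow> real) \<Rightarrow> (nat \<Rightarrow> nat) \<Rightarrow> complex \<Rightarrow> complex" where
  "calP \<rho> n \<alpha> \<beta> \<delta> \<kappa> x =
     hypergeom
       ([- of_nat n, of_real (real n + \<alpha> + \<beta> + 1)] @ map (\<lambda>j. of_real (\<delta> j + 1)) [1..<Suc \<rho>])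
       ([of_real (\<alpha> + 1)] @ map (\<lambda>j. of_real (real (\<kappa> j) + \<delta> j + 1)) [1..<Suc \<rho>])
       x"

definition calL ::
  "nat \<Rightarrow> nat \<Rightarrow> real \<Rightarrow> (nat \<Rightarrow> real) \<Rightarrow> (nat \<Rightarrow> nat) \<Rightarrow> complex \<Rightarrow> complex" where
  "calL \<rho> n \<alpha> \<delta> \<kappa> x =
     hypergeom
       ([- of_nat n] @ map (\<lambda>j. of_real (\<delta> j + 1)) [1..<Suc \<rho>])
       ([of_real (\<alpha> + 1)] @ map (\<lambda>j. of_real (real (\<kappa> j) + \<delta> j + 1)) [1..<Suc \<rho>])
       x"

text \<open>
  Jacobi and Laguerre polynomials, normalized to take the value \<open>1\<close> at the origin; the Jacobi
  polynomials are those for the interval \<open>[0, 1]\<close>.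
\<close>

definition jacobiJ :: "nat \<Rightarrow> real \<Rightarrow> real \<Rightarrow> complex \<Rightarrow> complex" where
  "jacobiJ n \<alpha> \<beta> x =
     hypergeom [- of_nat n, of_real (real n + \<alpha> + \<beta> + 1)] [of_real (\<alpha> + 1)] x"

definition laguerreL :: "nat \<Rightarrow> real \<Rightarrow> complex \<Rightarrow> complex" where
  "laguerreL n \<alpha> x = hypergeom [- of_nat n] [of_real (\<alpha> + 1)] x"

end

theory Submission
  imports Defs
begin

text \<open>
  For a terminating series the integral is taken term by term, and each term is a Beta integral:
  multiplied by the Gamma prefactor, the moment of order \<open>k\<close> of \<open>t powr d * (1 - t) ^ (m - 1)\<close>
  is \<open>pochhammer (d + 1) k / pochhammer (m + d + 1) k\<close>, which is exactly the pair of parameters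
  that the integral adds to the series.
\<close>

lemma has_bochner_integral_Beta:
  fixes a :: real and m :: nat
  assumes "a > 0" "m \<ge> 1"
  shows "has_bochner_integral lborel
           (\<lambda>t. indicator {0..1} t * (t powr (a - 1) * (1 - t) ^ (m - 1))) (Beta a m)"
proof (rule has_bochner_integral_nn_integral)
  have "((\<lambda>t. t powr (a - 1) * (1 - t) powr (real m - 1)) has_integral Beta a m) {0..1}"
    using assms by (intro has_integral_Beta_real) auto
  \<comment> \<open>At \<open>t = 1\<close> the two integrands differ if \<open>m = 1\<close>, since \<open>0 powr 0 = 0\<close>.\<close>
  then have "((\<lambda>t. t powr (a - 1) * (1 - t) ^ (m - 1)) has_integral Beta a m) {0..1}"
    by (rule has_integral_spike[of "{1}", rotated 2])
       (use assms in \<open>auto simp: powr_realpow[symmetric] of_nat_diff\<close>)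
  \<comment> \<open>The integrand is nonnegative on \<open>{0..1}\<close>, so the gauge integral is
    also a nonnegative Lebesgue integral; its finiteness yields integrability along with the
    value.\<close>
  then have "(\<integral>\<^sup>+t. ennreal (t powr (a - 1) * (1 - t) ^ (m - 1)) * indicator {0..1} t \<partial>lborel)
      = ennreal (Beta a m)"
    by (intro nn_integral_has_integral_lebesgue') auto
  moreover have "ennreal (indicator {0..1} t * (t powr (a - 1) * (1 - t) ^ (m - 1))) =
      ennreal (t powr (a - 1) * (1 - t) ^ (m - 1)) * indicator {0..1} t" for t :: real
    by (auto simp: indicator_def)
  ultimately show "(\<integral>\<^sup>+t. ennreal (indicator {0..1} t * (t powr (a - 1) * (1 - t) ^ (m - 1))) \<partial>lborel)
      = ennreal (Beta a m)"
    by simp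
  show "AE t in lborel. 0 \<le> indicator {0..1} t * (t powr (a - 1) * (1 - t) ^ (m - 1))"
    by (auto simp: indicator_def)
  show "0 \<le> Beta a (real m)"
    using assms by (auto simp: Beta_def intro!: divide_nonneg_pos mult_nonneg_nonneg less_imp_le)
qed measurable

text \<open>Write the Beta value as
  \<open>Gamma (d + k + 1) * Gamma m / Gamma (m + d + k + 1)\<close>: the factor
  \<open>Gamma m\<close> cancels, and what remains are two quotients of the form
  \<open>Gamma (c + k) / Gamma c = pochhammer c k\<close>.\<close>

lemma Beta_moment_eq_pochhammer:
  fixes d :: real and m k :: nat
  assumes "d > -1" "m \<ge> 1"
  shows "Gamma (real m + d + 1) / (Gamma (d + 1) * Gamma (real m)) * Beta (d + real k + 1) (real m)
    = pochhammer (d + 1) k / pochhammer (real m + d + 1) k"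
proof -
  \<comment> \<open>Both numbers are positive, hence not poles of \<open>Gamma\<close>, as the
    quotient formula for \<open>pochhammer\<close> demands.\<close>
  have "d + 1 \<notin> \<int>\<^sub>\<le>\<^sub>0" "real m + d + 1 \<notin> \<int>\<^sub>\<le>\<^sub>0"
    using assms by (auto elim!: nonpos_Ints_cases)
  then have "pochhammer (d + 1) k = Gamma (d + 1 + k) / Gamma (d + 1)"
    "pochhammer (real m + d + 1) k = Gamma (real m + d + 1 + k) / Gamma (real m + d + 1)"
    by (simp_all add: pochhammer_Gamma)
  moreover have "Gamma (real m) > 0"
    using assms by (intro Gamma_real_pos) auto
  ultimately show ?thesis
    by (simp add: Beta_def field_simps add_ac)
qed

text \<open>Keeping \<open>as\<close> and \<open>bs\<close> general lets one argument serve both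
  families of polynomials. Integrability is a conclusion of its own because a Lebesgue integral
  defaults to 0 for a non-integrable function.\<close>

lemma hypergeom_terminating_Euler_integral:
  fixes d :: real and m n :: nat and as bs :: "complex list" and z :: complex
  assumes d: "d > -1" and m: "m \<ge> 1" and n: "- of_nat n \<in> set as"
  defines "f \<equiv> \<lambda>t::real. complex_of_real (t powr d * (1 - t) ^ (m - 1)) *
    hypergeom as bs (z * complex_of_real t)"
  shows "set_integrable lborel {0..1} f"
    and "hypergeom (as @ [of_real (d + 1)]) (bs @ [of_real (real m + d + 1)]) z =
      complex_of_real (Gamma (real m + d + 1) / (Gamma (d + 1) * Gamma (real m))) *
      (LBINT t:{0..1}. f t)"
proof -
  define c where "c k =
    (\<Prod>a\<leftarrow>as. pochhammer a k) / (\<Prod>b\<leftarrow>bs. pochhammer b k) * (z ^ k / fact k)" for k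
  \<comment> \<open>The exponent is left as \<open>d + real k + 1 - 1\<close> so that
    \<open>has_bochner_integral_Beta\<close> applies verbatim with
    \<open>a = d + real k + 1\<close>.\<close>
  define w where "w k t = indicator {0..1} t * (t powr (d + real k + 1 - 1) * (1 - t) ^ (m - 1))"
    for k and t :: real
  define B where "B k = Beta (d + real k + 1) (real m)" for k
  define G where "G = Gamma (real m + d + 1) / (Gamma (d + 1) * Gamma (real m))"
  \<comment> \<open>The law \<open>t powr d * t ^ k = t powr (d + k)\<close> is used for positive
    \<open>t\<close>. At \<open>t = 0\<close> both sides vanish, since \<open>0 powr x = 0\<close>
    for every \<open>x\<close>, and for negative \<open>t\<close> the indicator is 0.\<close>
  have w: "indicator {0..1} t * (t powr d * (1 - t) ^ (m - 1)) * t ^ k = w k t" for k t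
    by (cases "t = 0"; cases "t < 0")
       (auto simp: w_def indicator_def powr_add powr_realpow)
  have "indicator {0..1} t *\<^sub>R f t = (\<Sum>k\<le>n. of_real (w k t) * c k)" for t
    unfolding w[symmetric] f_def hypergeom_terminating[OF n] c_def
    by (simp add: scaleR_conv_of_real sum_distrib_left power_mult_distrib mult_ac)
  moreover have "has_bochner_integral lborel (\<lambda>t. \<Sum>k\<le>n. of_real (w k t) * c k)
      (\<Sum>k\<le>n. of_real (B k) * c k)"
    unfolding w_def B_def
    by (intro has_bochner_integral_sum has_bochner_integral_mult_left
        has_bochner_integral_of_real has_bochner_integral_Beta) (use d m in auto)
  ultimately have int: "has_bochner_integral lborel (\<lambda>t. indicator {0..1} t *\<^sub>R f t)
      (\<Sum>k\<le>n. of_real (B k) * c k)"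
    by simp
  then show "set_integrable lborel {0..1} f"
    by (simp add: set_integrable_def has_bochner_integral_iff)
  from int have "(LBINT t:{0..1}. f t) = (\<Sum>k\<le>n. of_real (B k) * c k)"
    unfolding set_lebesgue_integral_def by (rule has_bochner_integral_integral_eq)
  then have "of_real G * (LBINT t:{0..1}. f t) = (\<Sum>k\<le>n. of_real (G * B k) * c k)"
    by (simp add: sum_distrib_left mult_ac)
  also have "\<dots> = hypergeom (as @ [of_real (d + 1)]) (bs @ [of_real (real m + d + 1)]) z"
    \<comment> \<open>The coefficient \<open>G * B k\<close> becomes a quotient of complex
      Pochhammer symbols, one for each appended parameter. The longer upper list still contains
      \<open>- of_nat n\<close>, so the new series is also cut off at \<open>n\<close>.\<close>
    unfolding G_def B_def Beta_moment_eq_pochhammer[OF d m] of_real_divide pochhammer_of_real[symmetric]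
    by (subst hypergeom_terminating[of n]) (use n in \<open>auto simp: c_def mult_ac\<close>)
  finally show "hypergeom (as @ [of_real (d + 1)]) (bs @ [of_real (real m + d + 1)]) z =
      complex_of_real (Gamma (real m + d + 1) / (Gamma (d + 1) * Gamma (real m))) *
      (LBINT t:{0..1}. f t)"
    by (simp add: G_def)
qed

theorem proposition1:
  fixes \<rho> n :: nat
    and \<alpha> \<beta> :: real
    and \<delta> :: "nat \<Rightarrow> real"
    and \<kappa> :: "nat \<Rightarrow> nat"
  assumes "\<rho> \<ge> 1"
    and "\<alpha> > -1" and "\<beta> > -1"
    and "\<And>j. j \<in> {1..\<rho>} \<Longrightarrow> \<delta> j > -1"
    and "\<And>j. j \<in> {1..\<rho>} \<Longrightarrow> \<kappa> j \<ge> 1"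
  shows "(\<rho> \<ge> 2 \<longrightarrow> (\<forall>z::complex. cmod z < 1 \<longrightarrow>
          set_integrable lborel {0..1} (\<lambda>t::real.
            complex_of_real (t powr \<delta> \<rho> * (1 - t) ^ (\<kappa> \<rho> - 1)) * calP (\<rho> - 1) n \<alpha> \<beta> \<delta> \<kappa> (z * complex_of_real t))
          \<and> calP \<rho> n \<alpha> \<beta> \<delta> \<kappa> z =
              complex_of_real (Gamma (real (\<kappa> \<rho>) + \<delta> \<rho> + 1) / (Gamma (\<delta> \<rho> + 1) * Gamma (real (\<kappa> \<rho>)))) *
              (LBINT t:{0..1}.
                complex_of_real (t powr \<delta> \<rho> * (1 - t) ^ (\<kappa> \<rho> - 1)) * calP (\<rho> - 1) n \<alpha> \<beta> \<delta> \<kappa> (z * complex_of_real t))))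
      \<and> (\<rho> = 1 \<longrightarrow> (\<forall>z::complex. cmod z < 1 \<longrightarrow>
          set_integrable lborel {0..1} (\<lambda>t::real.
            complex_of_real (t powr \<delta> 1 * (1 - t) ^ (\<kappa> 1 - 1)) * jacobiJ n \<alpha> \<beta> (z * complex_of_real t))
          \<and> calP \<rho> n \<alpha> \<beta> \<delta> \<kappa> z =
              complex_of_real (Gamma (real (\<kappa> 1) + \<delta> 1 + 1) / (Gamma (\<delta> 1 + 1) * Gamma (real (\<kappa> 1)))) *
              (LBINT t:{0..1}.
                complex_of_real (t powr \<delta> 1 * (1 - t) ^ (\<kappa> 1 - 1)) * jacobiJ n \<alpha> \<beta> (z * complex_of_real t))))
      \<and> (\<rho> \<ge> 2 \<longrightarrow> (\<forall>z::complex.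
          set_integrable lborel {0..1} (\<lambda>t::real.
            complex_of_real (t powr \<delta> \<rho> * (1 - t) ^ (\<kappa> \<rho> - 1)) * calL (\<rho> - 1) n \<alpha> \<delta> \<kappa> (z * complex_of_real t))
          \<and> calL \<rho> n \<alpha> \<delta> \<kappa> z =
              complex_of_real (Gamma (real (\<kappa> \<rho>) + \<delta> \<rho> + 1) / (Gamma (\<delta> \<rho> + 1) * Gamma (real (\<kappa> \<rho>)))) *
              (LBINT t:{0..1}.
                complex_of_real (t powr \<delta> \<rho> * (1 - t) ^ (\<kappa> \<rho> - 1)) * calL (\<rho> - 1) n \<alpha> \<delta> \<kappa> (z * complex_of_real t))))
      \<and> (\<rho> = 1 \<longrightarrow> (\<forall>z::complex.
          set_integrable lborel {0..1} (\<lambda>t::real.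
            complex_of_real (t powr \<delta> 1 * (1 - t) ^ (\<kappa> 1 - 1)) * laguerreL n \<alpha> (z * complex_of_real t))
          \<and> calL \<rho> n \<alpha> \<delta> \<kappa> z =
              complex_of_real (Gamma (real (\<kappa> 1) + \<delta> 1 + 1) / (Gamma (\<delta> 1 + 1) * Gamma (real (\<kappa> 1)))) *
              (LBINT t:{0..1}.
                complex_of_real (t powr \<delta> 1 * (1 - t) ^ (\<kappa> 1 - 1)) * laguerreL n \<alpha> (z * complex_of_real t))))"
proof -
  have d: "\<delta> \<rho> > -1" and m: "\<kappa> \<rho> \<ge> 1"
    using assms by auto
  \<comment> \<open>Splitting off the last parameter leaves exactly the list that occurs in
    \<open>calP (\<rho> - 1)\<close> and \<open>calL (\<rho> - 1)\<close>; reassociating the appends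
    then gives the shape \<open>as @ [_]\<close> of the Euler integral.\<close>
  have params: "map g [1..<Suc \<rho>] = map g [1..<Suc (\<rho> - 1)] @ [g \<rho>]" for g :: "nat \<Rightarrow> complex"
    using \<open>\<rho> \<ge> 1\<close> by (cases \<rho>) auto
  note Euler = hypergeom_terminating_Euler_integral[OF d m, of n]
  have P: "set_integrable lborel {0..1} (\<lambda>t::real.
        complex_of_real (t powr \<delta> \<rho> * (1 - t) ^ (\<kappa> \<rho> - 1)) * calP (\<rho> - 1) n \<alpha> \<beta> \<delta> \<kappa> (z * complex_of_real t))
      \<and> calP \<rho> n \<alpha> \<beta> \<delta> \<kappa> z =
        complex_of_real (Gamma (real (\<kappa> \<rho>) + \<delta> \<rho> + 1) / (Gamma (\<delta> \<rho> + 1) * Gamma (real (\<kappa> \<rho>)))) *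
        (LBINT t:{0..1}.
          complex_of_real (t powr \<delta> \<rho> * (1 - t) ^ (\<kappa> \<rho> - 1)) * calP (\<rho> - 1) n \<alpha> \<beta> \<delta> \<kappa> (z * complex_of_real t))" for z
    unfolding calP_def params append_assoc[symmetric] by (intro conjI Euler) auto
  have L: "set_integrable lborel {0..1} (\<lambda>t::real.
        complex_of_real (t powr \<delta> \<rho> * (1 - t) ^ (\<kappa> \<rho> - 1)) * calL (\<rho> - 1) n \<alpha> \<delta> \<kappa> (z * complex_of_real t))
      \<and> calL \<rho> n \<alpha> \<delta> \<kappa> z =
        complex_of_real (Gamma (real (\<kappa> \<rho>) + \<delta> \<rho> + 1) / (Gamma (\<delta> \<rho> + 1) * Gamma (real (\<kappa> \<rho>)))) *
        (LBINT t:{0..1}.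
          complex_of_real (t powr \<delta> \<rho> * (1 - t) ^ (\<kappa> \<rho> - 1)) * calL (\<rho> - 1) n \<alpha> \<delta> \<kappa> (z * complex_of_real t))" for z
    unfolding calL_def params append_assoc[symmetric] by (intro conjI Euler) auto
  \<comment> \<open>\<open>P\<close> and \<open>L\<close> treat \<open>\<rho> = 1\<close> and
    \<open>\<rho> \<ge> 2\<close> alike: for \<open>\<rho> = 1\<close> the integrand has index 0,
    where the parameter lists are empty and the classical polynomials appear.\<close>
  have J: "jacobiJ n \<alpha> \<beta> = calP 0 n \<alpha> \<beta> \<delta> \<kappa>" and La: "laguerreL n \<alpha> = calL 0 n \<alpha> \<delta> \<kappa>"
    by (simp_all add: fun_eq_iff jacobiJ_def calP_def laguerreL_def calL_def)
  show ?thesis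
    unfolding J La using P L by auto
qed

end
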